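(* Let $V=\{1,\ldots,n\}$, let $k$ be a positive integer, and let $f:2^V\to\mathbb{R}_+$ be a non-negative, normalized ($f(\emptyset)=0$), monotone submodular function that is dynamic $(c,\theta)$-monotonic sharp with parameters $c=(c_0,\ldots,c_{k-1})\in[1,\infty)^k$ and $\theta=(\theta_0,\ldots,\theta_{k-1})\in[0,1]^k$. Then the greedy algorithm returns a set $S^g$ for the problem $\max\{f(S):|S|\le k\}$ such that \[ f(S^g)\ \ge\ \Bigg[1 - \Bigg(\bigg(\Big(1-\frac{\theta_0}{c_0k}\Big)^{\frac{\theta_1}{\theta_0}} - \frac{\theta_1}{c_1k}\bigg)^{\frac{\theta_2}{\theta_1}} - \cdots - \frac{\theta_{k-1}}{c_{k-1}k}\Bigg)^{\frac{1}{\theta_{k-1}}}\Bigg]\cdot f(S^* ), \] where $S^*$ is the optimal solution from the sharpness definition. (Equivalently, with $u_1=1-\frac{\theta_0}{c_0k}$ and $u_{j+1}=u_j^{\theta_j/\theta_{j-1}}-\frac{\theta_j}{c_jk}$ for $j=1,\ldots,k-1$, the bound is $[1-u_k^{1/\theta_{k-1}}]f(S^* )$.)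
   Context: For $A\subseteq V$ and $e\in V$, $f_A(e):=f(A\cup\{e\})-f(A)$. $f$ is submodular if $f_A(e)\ge f_B(e)$ for all $A\subseteq B\subseteq V\setminus\{e\}$; monotone if $f(A)\le f(B)$ for $A\subseteq B$. The problem is $\max\{f(S):S\subseteq V,|S|\le k\}$. $f$ is dynamic $(c,\theta)$-monotonic sharp, with $c\in[1,\infty)^k$, $\theta\in[0,1]^k$, if there exists an optimal solution $S^*$ of this problem such that for every $S\subseteq V$ with $|S|\le k$, \[ \sum_{e\in S^*\setminus S} f_S(e)\ \ge\ \left(\frac{|S^*\setminus S|}{k\cdot c_{|S|}}\right)^{1/\theta_{|S|}}\cdot f(S^* ). \] The greedy algorithm starts with $S=\emptyset$ and, while $|S|<k$, adds to $S$ an element of $\arg\max_{e\in V\setminus S} f_S(e)$; its output is $S^g$. *)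

theory Defs
  imports "HOL-Analysis.Analysis"
begin

definition marginal :: "('a set \<Rightarrow> real) \<Rightarrow> 'a set \<Rightarrow> 'a \<Rightarrow> real" where
  "marginal f A e = f (A \<union> {e}) - f A"

definition submodular_on :: "'a set \<Rightarrow> ('a set \<Rightarrow> real) \<Rightarrow> bool" where
  "submodular_on V f \<longleftrightarrow>
     (\<forall>e\<in>V. \<forall>A B. A \<subseteq> B \<and> B \<subseteq> V - {e} \<longrightarrow> marginal f A e \<ge> marginal f B e)"

definition optimal_solution :: "'a set \<Rightarrow> nat \<Rightarrow> ('a set \<Rightarrow> real) \<Rightarrow> 'a set \<Rightarrow> bool" where
  "optimal_solution V k f S \<longleftrightarrow> is_arg_max f (\<lambda>A. A \<subseteq> V \<and> card A \<le> k) S"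

(* x^(1/\<theta>) for 0 \<le> x \<le> 1, with the limit for \<theta> tending to 0 from above taken at \<theta> = 0. *)
definition root_powr :: "real \<Rightarrow> real \<Rightarrow> real" where
  "root_powr x \<theta> = (if \<theta> = 0 then if x = 1 then 1 else 0 else x powr (1 / \<theta>))"

lemma root_powr_limit:
  assumes "0 \<le> x" "x \<le> 1"
  shows "((\<lambda>t. x powr (1 / t)) \<longlongrightarrow> root_powr x 0) (at_right 0)"
proof (cases "x = 0 \<or> x = 1")
  case False
  have inf: "filterlim (\<lambda>t::real. inverse t) at_top (at_right 0)"
    by (rule filterlim_inverse_at_top_right)
  have "((\<lambda>t. x powr (inverse t)) \<longlongrightarrow> 0) (at_right 0)"
  proof -
    have "ln x < 0" using False assms by simp
    then have "filterlim (\<lambda>t. ln x * inverse t) at_bot (at_right 0)"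
      by (rule filterlim_tendsto_neg_mult_at_bot[OF tendsto_const _ inf])
    then have "((\<lambda>t. exp (ln x * inverse t)) \<longlongrightarrow> 0) (at_right 0)"
      by (rule filterlim_compose[OF exp_at_bot])
    then show ?thesis using False by (simp add: powr_def mult.commute)
  qed
  then show ?thesis using False by (simp add: root_powr_def inverse_eq_divide)
qed (auto simp: root_powr_def)

(* The parameters c and \<theta> only have entries with index below k, hence card S < k:
   for card S = k the inequality is meaningless. *)
definition sharpness_witness ::
    "'a set \<Rightarrow> nat \<Rightarrow> (nat \<Rightarrow> real) \<Rightarrow> (nat \<Rightarrow> real) \<Rightarrow> ('a set \<Rightarrow> real) \<Rightarrow> 'a set \<Rightarrow> bool" where
  "sharpness_witness V k c \<theta> f Sopt \<longleftrightarrow>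
     optimal_solution V k f Sopt \<and>
     (\<forall>S. S \<subseteq> V \<and> card S < k \<longrightarrow>
        (\<Sum>e\<in>Sopt - S. marginal f S e) \<ge>
          root_powr (real (card (Sopt - S)) / (real k * c (card S))) (\<theta> (card S)) * f Sopt)"

definition dynamic_monotonic_sharp ::
    "'a set \<Rightarrow> nat \<Rightarrow> (nat \<Rightarrow> real) \<Rightarrow> (nat \<Rightarrow> real) \<Rightarrow> ('a set \<Rightarrow> real) \<Rightarrow> bool" where
  "dynamic_monotonic_sharp V k c \<theta> f \<longleftrightarrow> (\<exists>Sopt. sharpness_witness V k c \<theta> f Sopt)"

inductive greedy_run :: "'a set \<Rightarrow> nat \<Rightarrow> ('a set \<Rightarrow> real) \<Rightarrow> 'a set \<Rightarrow> bool"
  for V k f where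
  start: "greedy_run V k f {}"
| step: "\<lbrakk>greedy_run V k f S; card S < k; is_arg_max (marginal f S) (\<lambda>e. e \<in> V - S) e\<rbrakk>
         \<Longrightarrow> greedy_run V k f (insert e S)"

(* Ties are broken arbitrarily; if card V < k the run also ends when V is exhausted. *)
definition greedy_output :: "'a set \<Rightarrow> nat \<Rightarrow> ('a set \<Rightarrow> real) \<Rightarrow> 'a set \<Rightarrow> bool" where
  "greedy_output V k f S \<longleftrightarrow> greedy_run V k f S \<and> (k \<le> card S \<or> V - S = {})"

(* Indexing: u_seq k c \<theta> j is u_(j+1). *)
fun u_seq :: "nat \<Rightarrow> (nat \<Rightarrow> real) \<Rightarrow> (nat \<Rightarrow> real) \<Rightarrow> nat \<Rightarrow> real" where
  "u_seq k c \<theta> 0 = 1 - \<theta> 0 / (c 0 * real k)"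
| "u_seq k c \<theta> (Suc j) =
     u_seq k c \<theta> j powr (\<theta> (Suc j) / \<theta> j) - \<theta> (Suc j) / (c (Suc j) * real k)"

definition nested_factor :: "nat \<Rightarrow> (nat \<Rightarrow> real) \<Rightarrow> (nat \<Rightarrow> real) \<Rightarrow> real" where
  "nested_factor k c \<theta> = 1 - u_seq k c \<theta> (k - 1) powr (1 / \<theta> (k - 1))"

(* The nested formula divides by every \<theta> i. Where some \<theta> i = 0 it is read as a limit, with
   those entries replaced by \<epsilon> > 0. If all \<theta> i are positive this is the formula itself
   (greedy_factor_positive); in general the limit exists and does not depend on how positive
   parameters approach \<theta> (nested_factor_tendsto, greedy_factor_eq). *)
definition greedy_factor :: "nat \<Rightarrow> (nat \<Rightarrow> real) \<Rightarrow> (nat \<Rightarrow> real) \<Rightarrow> real" where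
  "greedy_factor k c \<theta> = Lim (at_right 0) (\<lambda>\<epsilon>. nested_factor k c (\<lambda>i. max \<epsilon> (\<theta> i)))"

lemma greedy_factor_positive:
  assumes "k > 0" "\<And>i. i < k \<Longrightarrow> \<theta> i > 0"
  shows "greedy_factor k c \<theta> = nested_factor k c \<theta>"
proof -
  have "eventually (\<lambda>\<epsilon>. \<forall>i\<in>{..<k}. \<epsilon> < \<theta> i) (at_right (0::real))"
  proof (intro eventually_ball_finite ballI)
    fix i assume "i \<in> {..<k}"
    then have "eventually (\<lambda>\<epsilon>. \<epsilon> \<in> {0<..<\<theta> i}) (at_right 0)"
      using assms(2) by (intro eventually_at_right_real) auto
    then show "eventually (\<lambda>\<epsilon>. \<epsilon> < \<theta> i) (at_right 0)" by (rule eventually_mono) auto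
  qed auto
  then have "eventually (\<lambda>\<epsilon>. nested_factor k c (\<lambda>i. max \<epsilon> (\<theta> i)) = nested_factor k c \<theta>) (at_right 0)"
  proof (rule eventually_mono)
    fix \<epsilon> assume lt: "\<forall>i\<in>{..<k}. \<epsilon> < \<theta> i"
    then have m: "max \<epsilon> (\<theta> i) = \<theta> i" if "i < k" for i
      using that by (simp add: max_absorb2 less_imp_le)
    have "j < k \<Longrightarrow> u_seq k c (\<lambda>i. max \<epsilon> (\<theta> i)) j = u_seq k c \<theta> j" for j
      by (induction j) (simp_all add: m)
    then show "nested_factor k c (\<lambda>i. max \<epsilon> (\<theta> i)) = nested_factor k c \<theta>"
      using assms(1) by (simp add: nested_factor_def m)
  qed
  then have "((\<lambda>\<epsilon>. nested_factor k c (\<lambda>i. max \<epsilon> (\<theta> i))) \<longlongrightarrow> nested_factor k c \<theta>) (at_right 0)"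
    by (rule tendsto_eventually)
  then show ?thesis
    unfolding greedy_factor_def by (intro tendsto_Lim) auto
qed

(* For positive \<theta> this is remaining k c \<theta> (Suc j) = u_(j+1) powr (1 / \<theta> j)
   (u_seq_remaining). *)
fun remaining :: "nat \<Rightarrow> (nat \<Rightarrow> real) \<Rightarrow> (nat \<Rightarrow> real) \<Rightarrow> nat \<Rightarrow> real" where
  "remaining k c \<theta> 0 = 1"
| "remaining k c \<theta> (Suc j) =
     (if \<theta> j = 0 then remaining k c \<theta> j * exp (- (1 / (c j * real k)))
      else (remaining k c \<theta> j powr \<theta> j - \<theta> j / (c j * real k)) powr (1 / \<theta> j))"

lemma u_seq_remaining:
  assumes "\<And>i. i \<le> j \<Longrightarrow> \<theta> i > 0"
  shows "remaining k c \<theta> (Suc j) = u_seq k c \<theta> j powr (1 / \<theta> j)"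
  using assms
proof (induction j)
  case 0
  then show ?case using "0"[of 0] by simp
next
  case (Suc j)
  have nz: "\<theta> j \<noteq> 0" "\<theta> (Suc j) \<noteq> 0" using Suc.prems[of j] Suc.prems[of "Suc j"] by auto
  have IH: "remaining k c \<theta> (Suc j) = u_seq k c \<theta> j powr (1 / \<theta> j)"
    using Suc by simp
  show ?case
    unfolding remaining.simps(2)[of k c \<theta> "Suc j"] IH using nz
    by (simp add: powr_powr)
qed

lemma power_decrement:
  fixes r a t :: real
  assumes "0 \<le> a" "a \<le> r" "0 < r" "r \<le> 1" "0 < t" "t \<le> 1"
  shows "(r - a) powr t \<le> r powr t - t * a" "r powr t - t * a \<le> 1"
proof -
  define s where "s = a / r"
  have s: "0 \<le> s" "s \<le> 1" using assms by (auto simp: s_def)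
  have "(1 - s) powr t * 1 powr (1 - t) \<le> t * (1 - s) + (1 - t) * 1"
    using Youngs_inequality_0[of t "1 - t" "1 - s" 1] assms s by (cases "s = 1") auto
  then have 1: "(1 - s) powr t \<le> 1 - t * s" by (simp add: algebra_simps)
  have "r - a = r * (1 - s)" using assms by (simp add: s_def field_simps)
  then have "(r - a) powr t = r powr t * (1 - s) powr t"
    using assms s by (simp add: powr_mult)
  also have "\<dots> \<le> r powr t * (1 - t * s)" using 1 by (intro mult_left_mono) auto
  also have "\<dots> = r powr t - t * a * (r powr t / r)"
    using assms by (simp add: s_def field_simps)
  also have "\<dots> \<le> r powr t - t * a * 1"
  proof -
    have "r powr 1 \<le> r powr t" using assms by (intro powr_mono') auto
    then have "1 \<le> r powr t / r" using assms by simp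
    then have "t * a * 1 \<le> t * a * (r powr t / r)" using assms by (intro mult_left_mono) auto
    then show ?thesis by simp
  qed
  finally show "(r - a) powr t \<le> r powr t - t * a" by simp
  have "r powr t \<le> 1" using assms by (simp add: powr_le1)
  moreover have "0 \<le> t * a" using assms by simp
  ultimately show "r powr t - t * a \<le> 1" by linarith
qed

lemma remaining_bounds:
  assumes "k > 0" "\<And>i. i < k \<Longrightarrow> c i \<ge> 1" "\<And>i. i < k \<Longrightarrow> 0 \<le> \<theta> i \<and> \<theta> i \<le> 1" "j \<le> k"
  shows "1 - real j / real k \<le> remaining k c \<theta> j \<and> remaining k c \<theta> j \<le> 1"
  using assms(4)
proof (induction j)
  case (Suc j)
  define r a t where "r = remaining k c \<theta> j" and "a = 1 / (c j * real k)" and "t = \<theta> j"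
  have j: "j < k" using Suc by simp
  have "real k \<le> c j * real k" using mult_right_mono[OF assms(2)[OF j], of "real k"] by simp
  then have a: "0 < a" "a \<le> 1 / real k" using assms(1) by (auto simp: a_def field_simps)
  have IH: "1 - real j / real k \<le> r" "r \<le> 1" using Suc by (auto simp: r_def)
  have "1 / real k \<le> 1 - real j / real k" using j assms(1) by (simp add: field_simps)
  then have ar: "a \<le> r" "0 < r" using a IH by linarith+
  have t: "0 \<le> t" "t \<le> 1" using assms(3)[OF j] by (auto simp: t_def)
  have "r - a \<le> remaining k c \<theta> (Suc j) \<and> remaining k c \<theta> (Suc j) \<le> 1"
  proof (cases "t = 0")
    case True
    have "1 - a \<le> exp (- a)" using exp_ge_add_one_self[of "- a"] by simp
    then have "r * (1 - a) \<le> r * exp (- a)" using ar by (intro mult_left_mono) auto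
    moreover have "r * a \<le> 1 * a" using IH a by (intro mult_right_mono) auto
    moreover have "r * exp (- a) \<le> 1" using IH a ar by (intro mult_le_one) auto
    ultimately show ?thesis using True by (simp add: algebra_simps r_def a_def t_def)
  next
    case False
    have e: "remaining k c \<theta> (Suc j) = (r powr t - t * a) powr (1 / t)"
      using False by (simp add: r_def a_def t_def)
    note d = power_decrement[of a r t]
    have d1: "(r - a) powr t \<le> r powr t - t * a" "r powr t - t * a \<le> 1"
      using d a ar IH t False by auto
    have "r - a = ((r - a) powr t) powr (1 / t)" using False ar by (simp add: powr_powr)
    also have "\<dots> \<le> (r powr t - t * a) powr (1 / t)" using d1 t by (intro powr_mono2) auto
    finally have "r - a \<le> remaining k c \<theta> (Suc j)" using e by simp
    moreover have "0 \<le> r powr t - t * a" using d1(1) powr_ge_zero[of "r - a" t] by linarith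
    then have "remaining k c \<theta> (Suc j) \<le> 1" using d1 e t by (simp add: powr_le1)
    ultimately show ?thesis by simp
  qed
  moreover have "1 - real (Suc j) / real k = 1 - real j / real k - 1 / real k"
    by (simp add: add_divide_distrib)
  ultimately show ?case using IH a by linarith
qed simp

lemma powr_root_limit:
  fixes T R :: "'x \<Rightarrow> real"
  assumes T: "(T \<longlongrightarrow> 0) F" "eventually (\<lambda>x. 0 < T x) F" and R: "(R \<longlongrightarrow> r) F" "0 < r"
  shows "((\<lambda>x. (R x powr T x - T x * a) powr (1 / T x)) \<longlongrightarrow> r * exp (- a)) F"
proof -
  define L where "L = (\<lambda>x. ln (R x))"
  define y where "y = (\<lambda>x. R x powr T x - T x * a)"
  have Rp: "eventually (\<lambda>x. 0 < R x) F" using R by (rule order_tendstoD(1))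
  have L: "(L \<longlongrightarrow> ln r) F" unfolding L_def using R by (intro tendsto_intros) auto
  have ex: "((\<lambda>x. exp (T x * L x)) \<longlongrightarrow> 1) F"
    using tendsto_exp[OF tendsto_mult[OF T(1) L]] by simp
  have q: "((\<lambda>x. (exp (T x * L x) - 1) / T x) \<longlongrightarrow> ln r) F"
  proof (rule tendsto_sandwich)
    show "(L \<longlongrightarrow> ln r) F" by fact
    show "((\<lambda>x. L x * exp (T x * L x)) \<longlongrightarrow> ln r) F" using tendsto_mult[OF L ex] by simp
    show "eventually (\<lambda>x. L x \<le> (exp (T x * L x) - 1) / T x) F"
      using T(2)
    proof (rule eventually_mono)
      fix x assume "0 < T x"
      then show "L x \<le> (exp (T x * L x) - 1) / T x"
        using exp_ge_add_one_self[of "T x * L x"] by (simp add: field_simps)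
    qed
    show "eventually (\<lambda>x. (exp (T x * L x) - 1) / T x \<le> L x * exp (T x * L x)) F"
      using T(2)
    proof (rule eventually_mono)
      fix x assume p: "0 < T x"
      let ?z = "T x * L x"
      have "(1 - ?z) * exp ?z \<le> exp (- ?z) * exp ?z"
        using exp_ge_add_one_self[of "- ?z"] by (intro mult_right_mono) auto
      then have "exp ?z - 1 \<le> ?z * exp ?z" by (simp add: algebra_simps flip: exp_add)
      then show "(exp ?z - 1) / T x \<le> L x * exp ?z"
        using p by (simp add: field_simps)
    qed
  qed
  have yL: "eventually (\<lambda>x. y x = exp (T x * L x) - T x * a) F"
    using Rp by (rule eventually_mono) (simp add: y_def L_def powr_def)
  have ylim: "(y \<longlongrightarrow> 1) F"
    using tendsto_diff[OF ex tendsto_mult[OF T(1) tendsto_const[of a]]] tendsto_cong[OF yL] by simp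
  have yp: "eventually (\<lambda>x. 0 < y x) F" using ylim by (rule order_tendstoD(1)) simp
  have q2: "((\<lambda>x. (y x - 1) / T x) \<longlongrightarrow> ln r - a) F"
  proof (rule Lim_transform_eventually[OF tendsto_diff[OF q tendsto_const[of a]]])
    show "eventually (\<lambda>x. (exp (T x * L x) - 1) / T x - a = (y x - 1) / T x) F"
      using yL T(2) by eventually_elim (simp add: field_simps)
  qed
  have l: "((\<lambda>x. ln (y x) / T x) \<longlongrightarrow> ln r - a) F"
  proof (rule tendsto_sandwich)
    show "((\<lambda>x. (y x - 1) / T x / y x) \<longlongrightarrow> ln r - a) F"
      using tendsto_divide[OF q2 ylim] by simp
    show "((\<lambda>x. (y x - 1) / T x) \<longlongrightarrow> ln r - a) F" by fact
    show "eventually (\<lambda>x. ln (y x) / T x \<le> (y x - 1) / T x) F"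
      using yp T(2) by eventually_elim (intro divide_right_mono ln_le_minus_one, auto)
    show "eventually (\<lambda>x. (y x - 1) / T x / y x \<le> ln (y x) / T x) F"
      using yp T(2)
    proof eventually_elim
      fix x assume p: "0 < y x" "0 < T x"
      have "ln (inverse (y x)) \<le> inverse (y x) - 1" using p by (intro ln_le_minus_one) auto
      then have "(y x - 1) / y x \<le> ln (y x)" using p by (simp add: ln_inverse diff_divide_distrib inverse_eq_divide ln_div)
      then have "(y x - 1) / y x / T x \<le> ln (y x) / T x" using p by (intro divide_right_mono) auto
      then show "(y x - 1) / T x / y x \<le> ln (y x) / T x" by (simp add: mult.commute)
    qed
  qed
  have "((\<lambda>x. exp (ln (y x) / T x)) \<longlongrightarrow> exp (ln r - a)) F" by (intro tendsto_exp l)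
  moreover have "exp (ln r - a) = r * exp (- a)" using R(2) by (simp add: exp_diff exp_minus field_simps)
  moreover have "eventually (\<lambda>x. exp (ln (y x) / T x) = y x powr (1 / T x)) F"
    using yp by (rule eventually_mono) (simp add: powr_def)
  ultimately have "((\<lambda>x. y x powr (1 / T x)) \<longlongrightarrow> r * exp (- a)) F"
    using Lim_transform_eventually by simp
  then show ?thesis by (simp add: y_def)
qed

lemma remaining_tendsto:
  assumes "k > 0" and c: "\<And>i. i < k \<Longrightarrow> c i \<ge> 1"
    and \<theta>: "\<And>i. i < k \<Longrightarrow> 0 \<le> \<theta> i \<and> \<theta> i \<le> 1"
    and T: "\<And>i. i < k \<Longrightarrow> ((\<lambda>x. T x i) \<longlongrightarrow> \<theta> i) F"
    and ev: "eventually (\<lambda>x. \<forall>i<k. 0 < T x i \<and> T x i \<le> 1) F"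
    and "j \<le> k"
  shows "((\<lambda>x. remaining k c (T x) j) \<longlongrightarrow> remaining k c \<theta> j) F"
  using \<open>j \<le> k\<close>
proof (induction j)
  case (Suc j)
  define a where "a = 1 / (c j * real k)"
  have j: "j < k" using Suc by simp
  have IH: "((\<lambda>x. remaining k c (T x) j) \<longlongrightarrow> remaining k c \<theta> j) F" using Suc by simp
  have "0 < 1 - real j / real k" using j by simp
  then have pos: "0 < remaining k c \<theta> j"
  proof -
    have "1 - real j / real k \<le> remaining k c \<theta> j \<and> remaining k c \<theta> j \<le> 1"
      by (intro remaining_bounds assms(1) c \<theta>) (use j in auto)
    then show ?thesis using \<open>0 < 1 - real j / real k\<close> by linarith
  qed
  have e: "eventually (\<lambda>x. (remaining k c (T x) j powr T x j - T x j * a) powr (1 / T x j)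
      = remaining k c (T x) (Suc j)) F"
    using ev by (rule eventually_mono) (use j in \<open>auto simp: a_def\<close>)
  have "((\<lambda>x. (remaining k c (T x) j powr T x j - T x j * a) powr (1 / T x j))
      \<longlongrightarrow> remaining k c \<theta> (Suc j)) F"
  proof (cases "\<theta> j = 0")
    case True
    have "eventually (\<lambda>x. 0 < T x j) F" using ev by (rule eventually_mono) (use j in auto)
    from powr_root_limit[OF _ this IH pos, of a] T[OF j] True show ?thesis by (simp add: a_def)
  next
    case False
    have nn: "eventually (\<lambda>x. 0 \<le> remaining k c (T x) j powr T x j - T x j * a) F"
      using ev
    proof (rule eventually_mono)
      fix x assume x: "\<forall>i<k. 0 < T x i \<and> T x i \<le> 1"
      let ?r = "remaining k c (T x) j"
      have b: "1 - real j / real k \<le> ?r \<and> ?r \<le> 1"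
        using x by (intro remaining_bounds assms(1) c) (use j in \<open>auto intro: less_imp_le\<close>)
      have "real k \<le> c j * real k" using mult_right_mono[OF c[OF j], of "real k"] by simp
      then have a: "0 < a" "a \<le> 1 / real k" using assms(1) by (auto simp: a_def field_simps)
      have "1 / real k \<le> 1 - real j / real k" using j assms(1) by (simp add: field_simps)
      then have ar: "a \<le> ?r" "0 < ?r" using a b by linarith+
      have "(?r - a) powr T x j \<le> ?r powr T x j - T x j * a"
        using power_decrement(1)[of a ?r "T x j"] x j a ar b by auto
      then show "0 \<le> ?r powr T x j - T x j * a"
        using powr_ge_zero[of "?r - a" "T x j"] by linarith
    qed
    have "((\<lambda>x. (remaining k c (T x) j powr T x j - T x j * a) powr (1 / T x j))
      \<longlongrightarrow> (remaining k c \<theta> j powr \<theta> j - \<theta> j * a) powr (1 / \<theta> j)) F"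
      using False \<theta>[OF j] pos nn
      by (intro tendsto_powr' tendsto_diff tendsto_mult tendsto_divide IH T[OF j] tendsto_const) auto
    then show ?thesis using False by (simp add: a_def)
  qed
  then show ?case using e by (rule Lim_transform_eventually)
qed simp

lemma nested_factor_tendsto:
  assumes "k > 0" and c: "\<And>i. i < k \<Longrightarrow> c i \<ge> 1"
    and \<theta>: "\<And>i. i < k \<Longrightarrow> 0 \<le> \<theta> i \<and> \<theta> i \<le> 1"
    and T: "\<And>i. i < k \<Longrightarrow> ((\<lambda>x. T x i) \<longlongrightarrow> \<theta> i) F"
    and ev: "eventually (\<lambda>x. \<forall>i<k. 0 < T x i \<and> T x i \<le> 1) F"
  shows "((\<lambda>x. nested_factor k c (T x)) \<longlongrightarrow> 1 - remaining k c \<theta> k) F"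
proof -
  have "((\<lambda>x. 1 - remaining k c (T x) k) \<longlongrightarrow> 1 - remaining k c \<theta> k) F"
    using remaining_tendsto[OF assms] by (intro tendsto_intros) auto
  moreover have "eventually (\<lambda>x. 1 - remaining k c (T x) k = nested_factor k c (T x)) F"
    using ev
  proof (rule eventually_mono)
    fix x assume "\<forall>i<k. 0 < T x i \<and> T x i \<le> 1"
    then have "remaining k c (T x) (Suc (k - 1)) = u_seq k c (T x) (k - 1) powr (1 / T x (k - 1))"
      using assms(1) by (intro u_seq_remaining) auto
    then show "1 - remaining k c (T x) k = nested_factor k c (T x)"
      using assms(1) by (simp add: nested_factor_def)
  qed
  ultimately show ?thesis by (rule Lim_transform_eventually)
qed

lemma greedy_factor_eq:
  assumes "k > 0" and "\<And>i. i < k \<Longrightarrow> c i \<ge> 1"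
    and \<theta>: "\<And>i. i < k \<Longrightarrow> 0 \<le> \<theta> i \<and> \<theta> i \<le> 1"
  shows "greedy_factor k c \<theta> = 1 - remaining k c \<theta> k"
proof -
  have "((\<lambda>\<epsilon>. max \<epsilon> (\<theta> i)) \<longlongrightarrow> \<theta> i) (at_right 0)" if "i < k" for i
  proof -
    have "((\<lambda>\<epsilon>. max \<epsilon> (\<theta> i)) \<longlongrightarrow> max 0 (\<theta> i)) (at_right 0)"
      by (intro tendsto_max tendsto_ident_at tendsto_const)
    then show ?thesis using \<theta>[OF that] by (simp add: max_absorb2)
  qed
  moreover have "eventually (\<lambda>\<epsilon>. \<forall>i<k. 0 < max \<epsilon> (\<theta> i) \<and> max \<epsilon> (\<theta> i) \<le> 1) (at_right 0)"
    by (rule eventually_mono[OF eventually_at_right_real[of 0 1]]) (use \<theta> in auto)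
  ultimately have "((\<lambda>\<epsilon>. nested_factor k c (\<lambda>i. max \<epsilon> (\<theta> i))) \<longlongrightarrow> 1 - remaining k c \<theta> k) (at_right 0)"
    by (intro nested_factor_tendsto assms) auto
  then show ?thesis unfolding greedy_factor_def by (intro tendsto_Lim) auto
qed

end

theory Submission
  imports Defs
begin

text \<open>Let \<open>x\<close> be the relative gap \<open>1 - f S / f Sopt\<close> of the current greedy set \<open>S\<close>,
  \<open>m\<close> the number of elements of \<open>Sopt - S\<close>, and \<open>W\<close> the sum of their marginals, divided by
  \<open>f Sopt\<close>. Submodularity gives \<open>W \<ge> x\<close> and sharpness gives \<open>m \<le> k c W\<^sup>\<theta>\<close>, so the greedy
  gain is at least \<open>W / m \<ge> W\<^sup>1\<^sup>-\<^sup>\<theta> / (k c) \<ge> x\<^sup>1\<^sup>-\<^sup>\<theta> / (k c)\<close>. By Bernoulli's inequality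
  the new gap \<open>x'\<close> then satisfies \<open>x'\<^sup>\<theta> \<le> x\<^sup>\<theta> - \<theta> / (k c)\<close>, which is the recursion
  for \<open>remaining\<close>.\<close>

section \<open>Bernoulli's inequality and submodular sums\<close>

text \<open>Weighted AM-GM applied to \<open>1 - s\<close> and \<open>1\<close> with weights
  \<open>t\<close> and \<open>1 - t\<close>; it is used for positive bases, so \<open>s = 1\<close>
  is treated apart.\<close>

lemma Bernoulli_powr_le:
  fixes s t :: real
  assumes "0 \<le> s" "s \<le> 1" "0 \<le> t" "t \<le> 1"
  shows "(1 - s) powr t \<le> 1 - t * s"
proof (cases "s = 1")
  case False
  have "(1 - s) powr t * 1 powr (1 - t) \<le> t * (1 - s) + (1 - t) * 1"
    using assms False by (intro Youngs_inequality_0) auto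
  then show ?thesis by (simp add: algebra_simps)
qed (use assms in auto)

text \<open>Telescoping: when \<open>T\<close> is added to \<open>S\<close> one element at a time,
  each element is added to a superset of \<open>S\<close>, where its marginal is at most the one
  over \<open>S\<close>.\<close>

lemma submodular_on_union_le:
  assumes sub: "submodular_on V f" and "finite T" "T \<subseteq> V" "S \<subseteq> V" "S \<inter> T = {}"
  shows "f (S \<union> T) - f S \<le> (\<Sum>e\<in>T. marginal f S e)"
  using assms(2-)
proof (induction T rule: finite_induct)
  case (insert e T)
  have "marginal f S e \<ge> marginal f (S \<union> T) e"
    using insert.hyps insert.prems by (intro sub[unfolded submodular_on_def, rule_format]) auto
  moreover have "f (S \<union> T) - f S \<le> (\<Sum>e\<in>T. marginal f S e)"
    using insert.prems by (intro insert.IH) auto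
  ultimately show ?case using insert.hyps by (simp add: marginal_def)
qed simp

section \<open>Greedy runs\<close>

lemma greedy_run_subset:
  assumes "greedy_run V k f S"
  shows "S \<subseteq> V"
  using assms by induction (auto simp: is_arg_max_def)

lemma greedy_run_card_le:
  assumes "greedy_run V k f S" "finite V"
  shows "card S \<le> k"
  using assms
proof induction
  case (step S e)
  have "finite S" by (rule finite_subset[OF greedy_run_subset[OF step.hyps(1)] step.prems])
  with step.hyps show ?case by (simp add: card_insert_if)
qed simp

text \<open>Run sizes are bounded by \<open>k\<close>, so some run is largest. It must have ended:
  otherwise a maximizer on the finite nonempty set \<open>V - S\<close> would extend it.\<close>

lemma greedy_output_exists:
  assumes "finite V"
  shows "\<exists>S. greedy_output V k f S"
proof -
  have "\<exists>S. greedy_run V k f S \<and> (\<forall>T. greedy_run V k f T \<longrightarrow> card T \<le> card S)"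
    using assms greedy_run_card_le[of V k f]
    by (intro ex_has_greatest_nat[of _ "{}" _ "Suc k"]) (auto intro: greedy_run.start le_imp_less_Suc)
  then obtain S where S: "greedy_run V k f S" "\<And>T. greedy_run V k f T \<Longrightarrow> card T \<le> card S"
    by blast
  have fS: "finite S" using greedy_run_subset[OF S(1)] assms finite_subset by blast
  have "k \<le> card S \<or> V - S = {}"
  proof (rule ccontr)
    assume *: "\<not> (k \<le> card S \<or> V - S = {})"
    have "Max (marginal f S ` (V - S)) \<in> marginal f S ` (V - S)"
      using * assms by (intro Max_in) auto
    then obtain e where "e \<in> V - S" "marginal f S e = Max (marginal f S ` (V - S))"
      by auto
    then have "is_arg_max (marginal f S) (\<lambda>e. e \<in> V - S) e"
      using assms unfolding is_arg_max_linorder by auto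
    then have "greedy_run V k f (insert e S)" using S(1) * by (intro greedy_run.step) auto
    from S(2)[OF this] show False using \<open>e \<in> V - S\<close> fS by simp
  qed
  with S(1) show ?thesis unfolding greedy_output_def by blast
qed

section \<open>Real inequalities behind one greedy step\<close>

text \<open>Here \<open>x\<close> and \<open>y\<close> are the relative gaps before and after a
  step, \<open>r\<close> is the bound on \<open>x\<close> already known, and \<open>a\<close> stands
  for \<open>1 / (k c)\<close>. The right-hand side is the recursion of \<open>remaining\<close>,
  with \<open>1 - a \<le> exp (- a)\<close> replacing Bernoulli at \<open>t = 0\<close>.\<close>

lemma gap_step:
  fixes x r a t :: real
  assumes "0 < x" "x \<le> r" "0 < a" "a \<le> 1" "0 \<le> t" "t \<le> 1"
    and y: "y \<le> x - x powr (1 - t) * a"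
  shows "y \<le> (if t = 0 then r * exp (- a) else (r powr t - t * a) powr (1 / t))"
proof (cases "t = 0")
  case True
  have "y \<le> x * (1 - a)" using y True assms by (simp add: algebra_simps)
  also have "\<dots> \<le> r * exp (- a)"
    using exp_ge_add_one_self[of "- a"] assms by (intro mult_mono) auto
  finally show ?thesis using True by simp
next
  case t: False
  have xt: "x powr (1 - t) = x / x powr t" "0 < x powr t" using assms by (auto simp: powr_diff)
  show ?thesis
  proof (cases "x powr t < a \<or> y \<le> 0")
    \<comment> \<open>If the gain term exceeds \<open>x\<close>, the new gap is nonpositive, while
      \<open>powr\<close> is nonnegative for every base.\<close>
    case True
    have "y \<le> 0"
    proof (cases "y \<le> 0")
      case False
      have "x * (1 - a / x powr t) \<le> 0"
        using False True assms xt(2) by (intro mult_nonneg_nonpos) (auto simp: field_simps)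
      then show ?thesis using y xt by (simp add: algebra_simps)
    qed
    also have "0 \<le> (r powr t - t * a) powr (1 / t)" by simp
    finally show ?thesis using t by simp
  next
    case False
    \<comment> \<open>The relative decrease of the gap:
      \<open>x - x powr (1 - t) * a = x * (1 - s)\<close>. The excluded case
      \<open>x powr t < a\<close> is what would make \<open>s > 1\<close>.\<close>
    define s where "s = a / x powr t"
    have s: "0 \<le> s" "s \<le> 1" using False assms xt(2) by (auto simp: s_def field_simps)
    have "y \<le> x * (1 - s)" using y xt by (simp add: s_def algebra_simps)
    then have "y powr t \<le> (x * (1 - s)) powr t" using False assms by (intro powr_mono2) auto
    also have "\<dots> = x powr t * (1 - s) powr t" using s assms by (simp add: powr_mult)
    also have "\<dots> \<le> x powr t * (1 - t * s)"
      using s assms by (intro mult_left_mono Bernoulli_powr_le) auto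
    also have "\<dots> = x powr t - t * a" using xt(2) by (simp add: s_def field_simps)
    also have "\<dots> \<le> r powr t - t * a" using assms by (intro diff_right_mono powr_mono2) auto
    finally have "(y powr t) powr (1 / t) \<le> (r powr t - t * a) powr (1 / t)"
      using assms by (intro powr_mono2) auto
    then show ?thesis using t False by (simp add: powr_powr)
  qed
qed

text \<open>For \<open>t > 0\<close>, sharpness reads \<open>m / K \<le> W powr t\<close>;
  multiplying by \<open>W powr (1 - t)\<close> leaves \<open>W\<close> on the right, and then
  \<open>x \<le> W\<close> applies. For \<open>t = 0\<close> the claim is just
  \<open>x \<le> W\<close> and \<open>m \<le> K\<close>.\<close>

lemma averaged_gain_bound:
  fixes x W m K t :: real
  assumes "0 < x" "x \<le> W" "0 < m" "m \<le> K" "0 \<le> t" "t \<le> 1"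
    and root: "root_powr (m / K) t \<le> W"
  shows "x powr (1 - t) / K \<le> W / m"
proof (cases "t = 0")
  case True
  have "x / K \<le> W / m" using assms by (intro frac_le) auto
  then show ?thesis using True assms by simp
next
  case False
  have "((m / K) powr (1 / t)) powr t \<le> W powr t"
    using assms False by (intro powr_mono2) (auto simp: root_powr_def)
  then have "m / K \<le> W powr t" using assms False by (simp add: powr_powr)
  then have "m * W powr (1 - t) / K \<le> W powr t * W powr (1 - t)"
    using mult_right_mono[of "m / K" "W powr t" "W powr (1 - t)"] by simp
  also have "\<dots> = W" using assms by (simp flip: powr_add)
  finally have "W powr (1 - t) / K \<le> W / m" using assms by (simp add: field_simps)
  moreover have "x powr (1 - t) / K \<le> W powr (1 - t) / K"
    using assms by (intro divide_right_mono powr_mono2) auto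
  ultimately show ?thesis by simp
qed

section \<open>Gain of a greedy step and decay of the gap\<close>

lemma greedy_gain:
  assumes "finite V" "k > 0"
    and monotone: "\<forall>A B. A \<subseteq> B \<and> B \<subseteq> V \<longrightarrow> f A \<le> f B"
    and sub: "submodular_on V f"
    and c: "1 \<le> c (card S)" and \<theta>: "0 \<le> \<theta> (card S)" "\<theta> (card S) \<le> 1"
    and wit: "sharpness_witness V k c \<theta> f Sopt"
    and S: "S \<subseteq> V" "card S < k" and gap: "f S < f Sopt" "0 < f Sopt"
    and e: "is_arg_max (marginal f S) (\<lambda>e. e \<in> V - S) e"
  shows "(1 - f S / f Sopt) powr (1 - \<theta> (card S)) / (c (card S) * real k) * f Sopt
    \<le> marginal f S e"
proof -
  define m K W where "m = real (card (Sopt - S))" and "K = real k * c (card S)"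
    and "W = (\<Sum>e\<in>Sopt - S. marginal f S e) / f Sopt"
  have opt: "Sopt \<subseteq> V" "card Sopt \<le> k"
    using wit by (auto simp: sharpness_witness_def optimal_solution_def is_arg_max_def)
  have fin: "finite (Sopt - S)" "finite Sopt" using opt(1) assms(1) finite_subset by auto
  \<comment> \<open>A positive gap ensures that there is something to average over.\<close>
  have "Sopt - S \<noteq> {}"
  proof
    assume "Sopt - S = {}"
    then have "f Sopt \<le> f S" using monotone S(1) by blast
    then show False using gap by simp
  qed
  then have m: "0 < m" using fin by (simp add: m_def card_gt_0_iff)
  have "card (Sopt - S) \<le> k" using card_mono[OF fin(2), of "Sopt - S"] opt(2) by auto
  then have "m \<le> real k * 1" by (simp add: m_def)
  also have "\<dots> \<le> K" unfolding K_def using c by (intro mult_left_mono) auto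
  finally have mK: "m \<le> K" .
  have "f Sopt \<le> f (S \<union> (Sopt - S))" using S(1) opt(1) by (intro monotone[rule_format]) auto
  moreover have "f (S \<union> (Sopt - S)) - f S \<le> W * f Sopt"
    using submodular_on_union_le[OF sub fin(1), of S] S(1) opt(1) gap(2) by (auto simp: W_def)
  ultimately have xW: "1 - f S / f Sopt \<le> W" using gap(2) by (simp add: field_simps)
  have "root_powr (m / K) (\<theta> (card S)) * f Sopt \<le> W * f Sopt"
    using wit S gap(2) unfolding sharpness_witness_def m_def K_def W_def by simp
  then have root: "root_powr (m / K) (\<theta> (card S)) \<le> W" using gap(2) by simp
  \<comment> \<open>Every element of \<open>Sopt - S\<close> is a candidate for the greedy choice,
    so the best marginal is at least their average.\<close>
  have "(\<Sum>e\<in>Sopt - S. marginal f S e) \<le> m * marginal f S e"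
    unfolding m_def using e opt(1) by (intro sum_bounded_above) (auto simp: is_arg_max_linorder)
  then have "W / m * f Sopt \<le> marginal f S e"
    using m gap(2) by (simp add: W_def field_simps)
  moreover have "(1 - f S / f Sopt) powr (1 - \<theta> (card S)) / K * f Sopt \<le> W / m * f Sopt"
    using xW root m mK \<theta> gap by (intro mult_right_mono averaged_gain_bound) auto
  ultimately show ?thesis by (simp add: K_def mult.commute)
qed

text \<open>Induction along the run. Each step adds a new element, so \<open>card S\<close> counts
  the steps and indexes the parameters of the next one.\<close>

lemma greedy_run_gap:
  assumes run: "greedy_run V k f S" and fin: "finite V" and "k > 0"
    and normalized: "f {} = 0"
    and monotone: "\<forall>A B. A \<subseteq> B \<and> B \<subseteq> V \<longrightarrow> f A \<le> f B"
    and sub: "submodular_on V f"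
    and c: "\<And>i. i < k \<Longrightarrow> c i \<ge> 1"
    and \<theta>: "\<And>i. i < k \<Longrightarrow> 0 \<le> \<theta> i \<and> \<theta> i \<le> 1"
    and wit: "sharpness_witness V k c \<theta> f Sopt" and pos: "0 < f Sopt"
  shows "1 - f S / f Sopt \<le> remaining k c \<theta> (card S)"
  using run
proof induction
  case start
  then show ?case by (simp add: normalized)
next
  case (step S e)
  note SV = greedy_run_subset[OF step.hyps(1)]
  have e: "e \<in> V - S" using step.hyps(3) by (simp add: is_arg_max_def)
  have card: "card (insert e S) = Suc (card S)"
    using e finite_subset[OF SV fin] by simp
  define x y a t where "x = 1 - f S / f Sopt" and "y = 1 - f (insert e S) / f Sopt"
    and "a = 1 / (c (card S) * real k)" and "t = \<theta> (card S)"
  have t: "0 \<le> t" "t \<le> 1" using \<theta>[OF step.hyps(2)] by (auto simp: t_def)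
  have c1: "1 \<le> c (card S)" by (rule c[OF step.hyps(2)])
  have a: "0 < a" "a \<le> 1"
    using c1 \<open>k > 0\<close> mult_mono[of 1 "c (card S)" 1 "real k"] by (auto simp: a_def)
  have "y \<le> remaining k c \<theta> (Suc (card S))"
  proof (cases "0 < x")
    case True
    then have "f S < f Sopt" using pos by (simp add: x_def)
    from greedy_gain[OF fin \<open>k > 0\<close> monotone sub c1 _ _ wit SV step.hyps(2) this pos step.hyps(3)]
    have "x powr (1 - t) * a * f Sopt \<le> f (insert e S) - f S"
      using t by (simp add: x_def a_def t_def marginal_def)
    then have "x powr (1 - t) * a \<le> (f (insert e S) - f S) / f Sopt"
      using pos by (simp add: pos_le_divide_eq)
    then have "y \<le> x - x powr (1 - t) * a" by (simp add: x_def y_def diff_divide_distrib)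
    from gap_step[OF True _ a t this, of "remaining k c \<theta> (card S)"] step.IH
    show ?thesis unfolding remaining.simps x_def a_def t_def by (auto split: if_splits)
  next
    case False
    \<comment> \<open>Once closed, the gap stays closed by monotonicity, and
      \<open>remaining\<close> is nonnegative up to index \<open>k\<close>.\<close>
    have "f S \<le> f (insert e S)" using monotone SV e by blast
    then have "f S / f Sopt \<le> f (insert e S) / f Sopt" using pos by (intro divide_right_mono) auto
    then have "y \<le> 0" using False by (simp add: x_def y_def)
    moreover have "1 - real (Suc (card S)) / real k \<le> remaining k c \<theta> (Suc (card S))"
      using step.hyps(2) by (intro remaining_bounds[THEN conjunct1] \<open>k > 0\<close> c \<theta>) auto
    moreover have "real (Suc (card S)) / real k \<le> 1"
      using step.hyps(2) by (simp add: field_simps)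
    ultimately show ?thesis by linarith
  qed
  then show ?case by (simp add: card y_def del: remaining.simps)
qed

theorem theorem2:
  fixes n k :: nat and V :: "nat set" and f :: "nat set \<Rightarrow> real" and c \<theta> :: "nat \<Rightarrow> real"
  assumes "V = {1..n}"
    and "k > 0"
    and nonneg: "\<forall>S\<subseteq>V. f S \<ge> 0"
    and normalized: "f {} = 0"
    and monotone: "\<forall>A B. A \<subseteq> B \<and> B \<subseteq> V \<longrightarrow> f A \<le> f B"
    and submodular: "submodular_on V f"
    and c: "\<forall>i<k. c i \<ge> 1"
    and \<theta>: "\<forall>i<k. \<theta> i \<in> {0..1}"
    and sharp: "dynamic_monotonic_sharp V k c \<theta> f"
  shows "(\<exists>Sg. greedy_output V k f Sg) \<and>
    (\<forall>Sg Sopt. greedy_output V k f Sg \<and> sharpness_witness V k c \<theta> f Sopt \<longrightarrow>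
       f Sg \<ge> greedy_factor k c \<theta> * f Sopt)"
proof (intro conjI allI impI; (elim conjE)?)
  have fin: "finite V" using assms(1) by simp
  then show "\<exists>Sg. greedy_output V k f Sg" by (rule greedy_output_exists)
  fix Sg Sopt
  assume out: "greedy_output V k f Sg" and wit: "sharpness_witness V k c \<theta> f Sopt"
  have c': "\<And>i. i < k \<Longrightarrow> c i \<ge> 1" and \<theta>': "\<And>i. i < k \<Longrightarrow> 0 \<le> \<theta> i \<and> \<theta> i \<le> 1"
    using c \<theta> by auto
  \<comment> \<open>This evaluates the limit even when entries of \<open>\<theta>\<close> vanish, so
    it suffices to bound the relative gap by \<open>remaining\<close>.\<close>
  have factor: "greedy_factor k c \<theta> = 1 - remaining k c \<theta> k"
    by (intro greedy_factor_eq \<open>k > 0\<close> c' \<theta>')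
  have run: "greedy_run V k f Sg" using out by (simp add: greedy_output_def)
  note sub = greedy_run_subset[OF run]
  have opt: "Sopt \<subseteq> V"
    using wit by (auto simp: sharpness_witness_def optimal_solution_def is_arg_max_def)
  show "greedy_factor k c \<theta> * f Sopt \<le> f Sg"
  \<comment> \<open>The relative gap divides by \<open>f Sopt\<close>; if that is zero, the claim is
    nonnegativity of \<open>f Sg\<close>.\<close>
  proof (cases "f Sopt = 0")
    case True
    then show ?thesis using nonneg sub by simp
  next
    case False
    then have pos: "0 < f Sopt" using nonneg opt by (simp add: less_le)
    show ?thesis
    proof (cases "k \<le> card Sg")
      case True
      then have "card Sg = k" using greedy_run_card_le[OF run fin] by simp
      then have "1 - f Sg / f Sopt \<le> remaining k c \<theta> k"
        using greedy_run_gap[OF run fin \<open>k > 0\<close> normalized monotone submodular c' \<theta>' wit pos]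
        by simp
      then show ?thesis using pos by (simp add: factor field_simps)
    next
      case False
      \<comment> \<open>The run ended early by exhausting \<open>V\<close>, so \<open>Sg\<close>
        contains \<open>Sopt\<close>; the factor is at most 1.\<close>
      then have "Sg = V" using out sub by (auto simp: greedy_output_def)
      then have "f Sopt \<le> f Sg" using monotone opt by blast
      moreover have "0 \<le> remaining k c \<theta> k"
        using remaining_bounds[of k c \<theta> k] c' \<theta>' \<open>k > 0\<close> by simp
      then have "greedy_factor k c \<theta> * f Sopt \<le> 1 * f Sopt"
        unfolding factor using pos by (intro mult_right_mono) auto
      ultimately show ?thesis by simp
    qed
  qed
qed

end
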